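(* Let $(X,T)$ be a minimal topological dynamical system. Then $(X,T)$ is either weakly mean equicontinuous or strong mean sensitive.
   Context: A topological dynamical system $(X,T)$ consists of a nonempty compact metric space $X$ with metric $d$ and a continuous map $T:X\to X$. It is minimal if every point of $X$ has dense forward orbit $\{x,Tx,T^2x,\dots\}$. $S_n$ denotes the group of permutations of $\{1,\dots,n\}$. For $x,y\in X$ put $\overline{F}(x,y)=\limsup_{n\to\infty}\inf_{\sigma\in S_n}\frac1n\sum_{k=1}^n d(T^kx,T^{\sigma(k)}y)$. $(X,T)$ is weakly mean equicontinuous if for every $\varepsilon>0$ there is $\delta>0$ such that $x,y\in X$, $d(x,y)<\delta$ imply $\overline{F}(x,y)<\varepsilon$. $(X,T)$ is strong mean sensitive if there exists $\delta>0$ such that for every $x\in X$ and every $\varepsilon>0$ there is $y\in X$ with $d(x,y)<\varepsilon$ and $\overline{F}(x,y)>\delta$. *)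

theory Defs
  imports "HOL-Analysis.Analysis"
begin

text \<open>
  The phase space is a set \<open>X\<close> in an ambient metric space type, with the metric \<^term>\<open>dist\<close>
  restricted to it; the map \<open>T\<close> matters only on \<open>X\<close>.
\<close>

definition topological_dynamical_system :: "'a::metric_space set \<Rightarrow> ('a \<Rightarrow> 'a) \<Rightarrow> bool" where
  "topological_dynamical_system X T \<longleftrightarrow>
     X \<noteq> {} \<and> compact X \<and> T \<in> X \<rightarrow> X \<and> continuous_on X T"

definition forward_orbit :: "('a \<Rightarrow> 'a) \<Rightarrow> 'a \<Rightarrow> 'a set" where
  "forward_orbit T x = {(T ^^ n) x | n. True}"

definition minimal_system :: "'a::metric_space set \<Rightarrow> ('a \<Rightarrow> 'a) \<Rightarrow> bool" where
  "minimal_system X T \<longleftrightarrow> (\<forall>x\<in>X. X \<subseteq> closure (forward_orbit T x))"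

text \<open>
  The infimum is a real one over the finite nonempty set of permutations of \<open>{1..n}\<close>.
  The limit superior is taken in \<^typ>\<open>ereal\<close>, where it always exists; on a bounded phase space
  it is finite and agrees with the real one. The term at \<open>n = 0\<close> is irrelevant.
\<close>

definition Fbar :: "('a::metric_space \<Rightarrow> 'a) \<Rightarrow> 'a \<Rightarrow> 'a \<Rightarrow> ereal" where
  "Fbar T x y =
     limsup (\<lambda>n. ereal (INF \<sigma>\<in>{\<sigma>. \<sigma> permutes {1..n}}.
       (1 / real n) * (\<Sum>k=1..n. dist ((T ^^ k) x) ((T ^^ \<sigma> k) y))))"

definition weakly_mean_equicontinuous :: "'a::metric_space set \<Rightarrow> ('a \<Rightarrow> 'a) \<Rightarrow> bool" where
  "weakly_mean_equicontinuous X T \<longleftrightarrow>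
     (\<forall>\<epsilon>::real. \<epsilon> > 0 \<longrightarrow>
       (\<exists>\<delta>::real. \<delta> > 0 \<and>
         (\<forall>x\<in>X. \<forall>y\<in>X. dist x y < \<delta> \<longrightarrow> Fbar T x y < ereal \<epsilon>)))"

definition strong_mean_sensitive :: "'a::metric_space set \<Rightarrow> ('a \<Rightarrow> 'a) \<Rightarrow> bool" where
  "strong_mean_sensitive X T \<longleftrightarrow>
     (\<exists>\<delta>::real. \<delta> > 0 \<and>
       (\<forall>x\<in>X. \<forall>\<epsilon>::real. \<epsilon> > 0 \<longrightarrow>
         (\<exists>y\<in>X. dist x y < \<epsilon> \<and> Fbar T x y > ereal \<delta>)))"

end

theory Submission
  imports Defs
begin

text \<open>
  The quantity \<^const>\<open>Fbar\<close> is an extended pseudometric: optimal matchings can be inverted and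
  composed, which yields symmetry and the triangle inequality. It moreover vanishes between \<open>x\<close>
  and \<open>T x\<close>, because cyclically shifting the time indices matches all but one of the first \<open>n\<close>
  orbit points exactly and the exceptional pair contributes only \<open>O(1/n)\<close>. Hence \<^const>\<open>Fbar\<close> does
  not change when both arguments are moved along their orbits.

  The dichotomy follows from the argument used for equicontinuity in minimal systems. Call \<open>x\<close> an
  \<open>\<epsilon>\<close>-point (\<open>Fbar_small_near\<close> below) if any two points sufficiently near \<open>x\<close> are at
  \<^const>\<open>Fbar\<close>-distance below \<open>\<epsilon>\<close>.
  The set of \<open>\<epsilon>\<close>-points is open and, by invariance of \<^const>\<open>Fbar\<close> and continuity of \<open>T\<close>, closed
  under preimages. In a minimal system every orbit enters every nonempty open set, so the set is
  either empty or all of \<open>X\<close>. If it is \<open>X\<close> for every \<open>\<epsilon>\<close>, compactness makes the neighbourhoods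
  uniform and the system is weakly mean equicontinuous. If it is empty for some \<open>\<epsilon>\<close>, then
  arbitrarily near each \<open>x\<close> there are two points at distance at least \<open>\<epsilon>\<close>, and by the triangle
  inequality one of them is farther than \<open>\<epsilon>/3\<close> from \<open>x\<close>.
  The two alternatives exclude each other because sensitivity at any single point contradicts
  equicontinuity there, and \<open>X\<close> is nonempty.
\<close>

section \<open>Optimal matchings of finite sequences\<close>

definition matching_mean :: "nat \<Rightarrow> (nat \<Rightarrow> 'a::metric_space) \<Rightarrow> (nat \<Rightarrow> 'a) \<Rightarrow> real" where
  "matching_mean n u v =
     (INF \<sigma>\<in>{\<sigma>. \<sigma> permutes {1..n}}. (1 / real n) * (\<Sum>k=1..n. dist (u k) (v (\<sigma> k))))"

lemma Fbar_eq_limsup_matching_mean: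
  "Fbar T x y = limsup (\<lambda>n. ereal (matching_mean n (\<lambda>k. (T ^^ k) x) (\<lambda>k. (T ^^ k) y)))"
  by (simp add: Fbar_def matching_mean_def)

lemma matching_mean_le:
  assumes "\<sigma> permutes {1..n}"
  shows "matching_mean n u v \<le> (1 / real n) * (\<Sum>k=1..n. dist (u k) (v (\<sigma> k)))"
  unfolding matching_mean_def
proof (rule cINF_lower)
  show "bdd_below ((\<lambda>\<sigma>. (1 / real n) * (\<Sum>k=1..n. dist (u k) (v (\<sigma> k)))) ` {\<sigma>. \<sigma> permutes {1..n}})"
    by (intro bdd_below_finite finite_imageI finite_permutations) simp
qed (use assms in simp)

lemma matching_mean_attained:
  obtains \<sigma> where "\<sigma> permutes {1..n}"
    and "matching_mean n u v = (1 / real n) * (\<Sum>k=1..n. dist (u k) (v (\<sigma> k)))"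
proof -
  let ?S = "{\<sigma>. \<sigma> permutes {1..n}}"
  let ?f = "\<lambda>\<sigma>. (1 / real n) * (\<Sum>k=1..n. dist (u k) (v (\<sigma> k)))"
  have fin: "finite (?f ` ?S)" by (intro finite_imageI finite_permutations) simp
  have ne: "?f ` ?S \<noteq> {}" using permutes_id by blast
  have "matching_mean n u v = Min (?f ` ?S)"
    unfolding matching_mean_def by (rule cInf_eq_Min[OF fin ne])
  then have "matching_mean n u v \<in> ?f ` ?S" using Min_in[OF fin ne] by simp
  then show ?thesis using that by blast
qed

lemma matching_mean_commute_le: "matching_mean n v u \<le> matching_mean n u v"
proof -
  obtain \<sigma> where \<sigma>: "\<sigma> permutes {1..n}"
    and eq: "matching_mean n u v = (1 / real n) * (\<Sum>k=1..n. dist (u k) (v (\<sigma> k)))"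
    by (rule matching_mean_attained)
  have "(\<Sum>k=1..n. dist (u k) (v (\<sigma> k))) = (\<Sum>k=1..n. dist (u (inv \<sigma> k)) (v (\<sigma> (inv \<sigma> k))))"
    using sum.permute[OF permutes_inv[OF \<sigma>], of "\<lambda>k. dist (u k) (v (\<sigma> k))"] by (simp add: o_def)
  also have "\<dots> = (\<Sum>k=1..n. dist (v k) (u (inv \<sigma> k)))"
    using permutes_inverses(1)[OF \<sigma>] by (simp add: dist_commute)
  finally show ?thesis using matching_mean_le[OF permutes_inv[OF \<sigma>], of v u] eq by simp
qed

text \<open>A matching of \<open>u\<close> with \<open>v\<close> followed by one of \<open>v\<close> with \<open>w\<close> is a matching of \<open>u\<close> with \<open>w\<close>,
  so the pointwise triangle inequality can be summed.\<close>

lemma matching_mean_triangle: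
  "matching_mean n u w \<le> matching_mean n u v + matching_mean n v w"
proof -
  obtain \<sigma> where \<sigma>: "\<sigma> permutes {1..n}"
    and eq\<sigma>: "matching_mean n u v = (1 / real n) * (\<Sum>k=1..n. dist (u k) (v (\<sigma> k)))"
    by (rule matching_mean_attained)
  obtain \<tau> where \<tau>: "\<tau> permutes {1..n}"
    and eq\<tau>: "matching_mean n v w = (1 / real n) * (\<Sum>k=1..n. dist (v k) (w (\<tau> k)))"
    by (rule matching_mean_attained)
  have "matching_mean n u w \<le> (1 / real n) * (\<Sum>k=1..n. dist (u k) (w ((\<tau> \<circ> \<sigma>) k)))"
    by (rule matching_mean_le[OF permutes_compose[OF \<sigma> \<tau>]])
  also have "\<dots> \<le> (1 / real n) *
      (\<Sum>k=1..n. dist (u k) (v (\<sigma> k)) + dist (v (\<sigma> k)) (w (\<tau> (\<sigma> k))))"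
    by (intro mult_left_mono sum_mono) (auto simp: dist_triangle)
  also have "(\<Sum>k=1..n. dist (u k) (v (\<sigma> k)) + dist (v (\<sigma> k)) (w (\<tau> (\<sigma> k)))) =
      (\<Sum>k=1..n. dist (u k) (v (\<sigma> k))) + (\<Sum>k=1..n. dist (v k) (w (\<tau> k)))"
    using sum.permute[OF \<sigma>, of "\<lambda>k. dist (v k) (w (\<tau> k))"] by (simp add: sum.distrib o_def)
  finally show ?thesis by (simp add: eq\<sigma> eq\<tau> distrib_left)
qed

lemma matching_mean_shift_le:
  assumes "n > 0"
  shows "matching_mean n u (\<lambda>k. u (Suc k)) \<le> dist (u 1) (u (Suc n)) / real n"
proof -
  \<comment> \<open>Since the second sequence is shifted by one, the cyclic shift backwards pairs \<open>u k\<close> with itself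
    for \<open>k \<ge> 2\<close>; only \<open>u 1\<close> gets a foreign partner, the last term \<open>u (Suc n)\<close>.\<close>
  define \<sigma> where "\<sigma> k = (if k \<in> {1..n} then if k = 1 then n else k - 1 else k)" for k
  have "bij_betw \<sigma> {1..n} {1..n}"
    by (rule bij_betw_byWitness[where f' = "\<lambda>k. if k = n then 1 else Suc k"])
      (auto simp: \<sigma>_def)
  then have \<sigma>: "\<sigma> permutes {1..n}"
    by (rule bij_imp_permutes) (auto simp: \<sigma>_def)
  have "(\<Sum>k=1..n. dist (u k) (u (Suc (\<sigma> k)))) =
      (\<Sum>k=1..n. if k = 1 then dist (u 1) (u (Suc n)) else 0)"
    by (rule sum.cong) (auto simp: \<sigma>_def)
  also have "\<dots> = dist (u 1) (u (Suc n))" using assms by simp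
  finally show ?thesis using matching_mean_le[OF \<sigma>, of u "\<lambda>k. u (Suc k)"] by simp
qed

section \<open>The pseudometric on the phase space\<close>

lemma Fbar_commute: "Fbar T x y = Fbar T y x"
  unfolding Fbar_eq_limsup_matching_mean
  by (intro arg_cong[where f = limsup] ext arg_cong[where f = ereal] order_antisym
        matching_mean_commute_le)

lemma Fbar_triangle: "Fbar T x z \<le> Fbar T x y + Fbar T y z"
proof -
  have "Fbar T x z \<le> limsup (\<lambda>n. ereal (matching_mean n (\<lambda>k. (T ^^ k) x) (\<lambda>k. (T ^^ k) y))
      + ereal (matching_mean n (\<lambda>k. (T ^^ k) y) (\<lambda>k. (T ^^ k) z)))"
    unfolding Fbar_eq_limsup_matching_mean
    by (intro Limsup_mono always_eventually) (simp add: matching_mean_triangle)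
  also have "\<dots> \<le> Fbar T x y + Fbar T y z"
    unfolding Fbar_eq_limsup_matching_mean by (rule ereal_limsup_add_mono)
  finally show ?thesis .
qed

lemma Fbar_image_self:
  assumes "bounded (range (\<lambda>n. (T ^^ n) x))"
  shows "Fbar T x (T x) \<le> 0"
proof -
  obtain B where B: "\<And>i j. dist ((T ^^ i) x) ((T ^^ j) x) \<le> B"
    using assms bounded_two_points by (metis rangeI)
  have lim: "(\<lambda>n. ereal (B / real n)) \<longlonglongrightarrow> ereal 0"
    by (intro tendsto_ereal lim_const_over_n)
  have "matching_mean n (\<lambda>k. (T ^^ k) x) (\<lambda>k. (T ^^ k) (T x)) \<le> B / real n" if "n > 0" for n
  proof -
    have "matching_mean n (\<lambda>k. (T ^^ k) x) (\<lambda>k. (T ^^ k) (T x)) \<le>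
        dist ((T ^^ 1) x) ((T ^^ Suc n) x) / real n"
      using matching_mean_shift_le[OF that, of "\<lambda>k. (T ^^ k) x"]
      by (simp add: funpow_swap1)
    also have "\<dots> \<le> B / real n" by (intro divide_right_mono B) simp
    finally show ?thesis .
  qed
  then have "Fbar T x (T x) \<le> limsup (\<lambda>n. ereal (B / real n))"
    unfolding Fbar_eq_limsup_matching_mean
    by (intro Limsup_mono eventually_mono[OF eventually_gt_at_top[of 0]]) simp
  also have "\<dots> = 0" using lim_imp_Limsup[OF _ lim] by (simp add: zero_ereal_def)
  finally show ?thesis .
qed

text \<open>Both detours, from \<open>x\<close> to \<open>T x\<close> and from \<open>T y\<close> to \<open>y\<close>, cost nothing.\<close>

lemma Fbar_le_Fbar_image:
  assumes "bounded (range (\<lambda>n. (T ^^ n) x))" and "bounded (range (\<lambda>n. (T ^^ n) y))"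
  shows "Fbar T x y \<le> Fbar T (T x) (T y)"
proof -
  have "Fbar T x y \<le> Fbar T x (T x) + (Fbar T (T x) (T y) + Fbar T (T y) y)"
    using Fbar_triangle[of T x y "T x"] Fbar_triangle[of T "T x" y "T y"]
    by (meson add_left_mono order_trans)
  also have "\<dots> \<le> 0 + (Fbar T (T x) (T y) + 0)"
    using Fbar_image_self[OF assms(1)] Fbar_image_self[OF assms(2)]
    by (intro add_mono) (auto simp: Fbar_commute[of T "T y" y])
  finally show ?thesis by simp
qed

section \<open>Points of local smallness\<close>

text \<open>Asking for a bound between two arbitrary nearby points, rather than between \<open>x\<close> and a
  nearby point, is what makes the set of such \<open>x\<close> open.\<close>

definition Fbar_small_near :: "'a::metric_space set \<Rightarrow> ('a \<Rightarrow> 'a) \<Rightarrow> real \<Rightarrow> 'a \<Rightarrow> bool" where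
  "Fbar_small_near X T \<epsilon> x \<longleftrightarrow>
     (\<exists>\<delta>>0. \<forall>y\<in>X. \<forall>z\<in>X. dist x y < \<delta> \<longrightarrow> dist x z < \<delta> \<longrightarrow> Fbar T y z < ereal \<epsilon>)"

lemma Fbar_small_near_open:
  assumes "Fbar_small_near X T \<epsilon> w"
  obtains \<delta> where "\<delta> > 0" "\<And>u. dist u w < \<delta> \<Longrightarrow> Fbar_small_near X T \<epsilon> u"
proof -
  obtain \<delta> where \<delta>: "\<delta> > 0"
    "\<And>y z. y \<in> X \<Longrightarrow> z \<in> X \<Longrightarrow> dist w y < \<delta> \<Longrightarrow> dist w z < \<delta> \<Longrightarrow> Fbar T y z < ereal \<epsilon>"
    using assms unfolding Fbar_small_near_def by blast
  have "Fbar_small_near X T \<epsilon> u" if u: "dist u w < \<delta> / 2" for u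
  proof -
    have near: "dist w y < \<delta>" if "dist u y < \<delta> / 2" for y
      using dist_triangle2[of w y u] dist_triangle[of w y u] that u by (simp add: dist_commute)
    show ?thesis unfolding Fbar_small_near_def
      by (rule exI[of _ "\<delta> / 2"]) (use \<delta> near in auto)
  qed
  then show ?thesis using that[of "\<delta> / 2"] \<delta>(1) by simp
qed

lemma funpow_in_invariant:
  assumes "T \<in> X \<rightarrow> X" "x \<in> X"
  shows "(T ^^ n) x \<in> X"
  using assms by (induction n) auto

text \<open>Continuity sends points near \<open>x\<close> to points near \<open>T x\<close>, and passing from two points to their
  images does not decrease \<^const>\<open>Fbar\<close>.\<close>

lemma Fbar_small_near_preimage:
  assumes "topological_dynamical_system X T" and "x \<in> X" and "Fbar_small_near X T \<epsilon> (T x)"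
  shows "Fbar_small_near X T \<epsilon> x"
proof -
  have inv: "T \<in> X \<rightarrow> X" and "compact X" and cont: "continuous_on X T"
    using assms(1) unfolding topological_dynamical_system_def by auto
  have bdd: "bounded (range (\<lambda>n. (T ^^ n) y))" if "y \<in> X" for y
    by (rule bounded_subset[OF compact_imp_bounded[OF \<open>compact X\<close>]])
      (auto intro: funpow_in_invariant[OF inv that])
  obtain \<delta> where \<delta>: "\<delta> > 0"
    "\<And>y z. y \<in> X \<Longrightarrow> z \<in> X \<Longrightarrow> dist (T x) y < \<delta> \<Longrightarrow> dist (T x) z < \<delta> \<Longrightarrow> Fbar T y z < ereal \<epsilon>"
    using assms(3) unfolding Fbar_small_near_def by blast
  obtain \<eta> where \<eta>: "\<eta> > 0" "\<And>y. y \<in> X \<Longrightarrow> dist x y < \<eta> \<Longrightarrow> dist (T x) (T y) < \<delta>"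
    using cont \<delta>(1) assms(2) unfolding continuous_on_iff by (metis dist_commute)
  have "Fbar T y z < ereal \<epsilon>" if "y \<in> X" "z \<in> X" "dist x y < \<eta>" "dist x z < \<eta>" for y z
  proof -
    have "Fbar T y z \<le> Fbar T (T y) (T z)"
      by (rule Fbar_le_Fbar_image) (use bdd that in auto)
    also have "\<dots> < ereal \<epsilon>" by (rule \<delta>(2)) (use that inv \<eta>(2) in auto)
    finally show ?thesis .
  qed
  then show ?thesis unfolding Fbar_small_near_def using \<eta>(1) by blast
qed

text \<open>The orbit of \<open>x\<close> enters the neighbourhood of \<open>w\<close> on which smallness holds; smallness is then
  pulled back along the orbit, one preimage at a time.\<close>

lemma Fbar_small_near_all_if_one:
  assumes sys: "topological_dynamical_system X T" and "minimal_system X T"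
    and "w \<in> X" and "Fbar_small_near X T \<epsilon> w" and "x \<in> X"
  shows "Fbar_small_near X T \<epsilon> x"
proof -
  have inv: "T \<in> X \<rightarrow> X" using sys unfolding topological_dynamical_system_def by auto
  obtain \<delta> where \<delta>: "\<delta> > 0" "\<And>u. dist u w < \<delta> \<Longrightarrow> Fbar_small_near X T \<epsilon> u"
    by (rule Fbar_small_near_open[OF assms(4)]) blast
  have "w \<in> closure (forward_orbit T x)" using assms unfolding minimal_system_def by auto
  then obtain n where "dist ((T ^^ n) x) w < \<delta>"
    using \<delta>(1) unfolding closure_approachable forward_orbit_def by blast
  then have "Fbar_small_near X T \<epsilon> ((T ^^ n) x)" by (rule \<delta>(2))
  then show ?thesis
  proof (induction n)
    case (Suc n)
    then show ?case
      using Fbar_small_near_preimage[OF sys funpow_in_invariant[OF inv \<open>x \<in> X\<close>]] by simp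
  qed simp
qed

section \<open>The dichotomy\<close>

text \<open>A Lebesgue number of the cover by the neighbourhoods of smallness is a modulus that serves
  all points at once.\<close>

lemma weakly_mean_equicontinuousI_local:
  assumes "compact X" and small: "\<And>\<epsilon> x. \<epsilon> > 0 \<Longrightarrow> x \<in> X \<Longrightarrow> Fbar_small_near X T \<epsilon> x"
  shows "weakly_mean_equicontinuous X T"
  unfolding weakly_mean_equicontinuous_def
proof (intro allI impI)
  fix \<epsilon> :: real assume "\<epsilon> > 0"
  define C where "C = {U. open U \<and> (\<forall>y\<in>X \<inter> U. \<forall>z\<in>X \<inter> U. Fbar T y z < ereal \<epsilon>)}"
  have "X \<subseteq> \<Union>C"
  proof
    fix x assume "x \<in> X"
    then obtain \<delta> where "\<delta> > 0"
      "\<And>y z. y \<in> X \<Longrightarrow> z \<in> X \<Longrightarrow> dist x y < \<delta> \<Longrightarrow> dist x z < \<delta> \<Longrightarrow> Fbar T y z < ereal \<epsilon>"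
      using small[OF \<open>\<epsilon> > 0\<close>] unfolding Fbar_small_near_def by blast
    then have "ball x \<delta> \<in> C" "x \<in> ball x \<delta>" by (auto simp: C_def)
    then show "x \<in> \<Union>C" by blast
  qed
  moreover have "\<And>U. U \<in> C \<Longrightarrow> open U" by (simp add: C_def)
  ultimately obtain \<delta> where "\<delta> > 0" and \<delta>: "\<forall>x\<in>X. \<exists>U\<in>C. ball x \<delta> \<subseteq> U"
    using Heine_Borel_lemma[OF \<open>compact X\<close>, of C] by metis
  have "Fbar T x y < ereal \<epsilon>" if "x \<in> X" "y \<in> X" "dist x y < \<delta>" for x y
  proof -
    obtain U where U: "U \<in> C" "ball x \<delta> \<subseteq> U" using \<delta> \<open>x \<in> X\<close> by blast
    have "x \<in> U" "y \<in> U" using U(2) that(3) \<open>\<delta> > 0\<close> by auto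
    then show ?thesis using U(1) that unfolding C_def by auto
  qed
  then show "\<exists>\<delta>>0. \<forall>x\<in>X. \<forall>y\<in>X. dist x y < \<delta> \<longrightarrow> Fbar T x y < ereal \<epsilon>"
    using \<open>\<delta> > 0\<close> by blast
qed

text \<open>If both members of a pair at distance at least \<open>\<epsilon>\<close> were within \<open>\<epsilon>/3\<close> of \<open>x\<close>, their mutual
  distance would be at most \<open>2\<epsilon>/3\<close>. The constant is below \<open>\<epsilon>/2\<close> because sensitivity asks for a
  strict inequality.\<close>

lemma strong_mean_sensitiveI_local:
  assumes "\<epsilon> > 0" and none: "\<And>x. x \<in> X \<Longrightarrow> \<not> Fbar_small_near X T \<epsilon> x"
  shows "strong_mean_sensitive X T"
  unfolding strong_mean_sensitive_def
proof (intro exI[of _ "\<epsilon> / 3"] conjI ballI allI impI)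
  show "\<epsilon> / 3 > 0" using \<open>\<epsilon> > 0\<close> by simp
  fix x and r :: real assume "x \<in> X" "r > 0"
  then obtain y z where yz: "y \<in> X" "z \<in> X" "dist x y < r" "dist x z < r"
      "\<not> Fbar T y z < ereal \<epsilon>"
    using none unfolding Fbar_small_near_def by blast
  have "Fbar T x y > ereal (\<epsilon> / 3) \<or> Fbar T x z > ereal (\<epsilon> / 3)"
  proof (rule ccontr)
    assume "\<not> ?thesis"
    then have "Fbar T y x + Fbar T x z \<le> ereal (\<epsilon> / 3) + ereal (\<epsilon> / 3)"
      by (intro add_mono) (auto simp: Fbar_commute[of T y x] not_less)
    also have "\<dots> < ereal \<epsilon>" using \<open>\<epsilon> > 0\<close> by simp
    finally show False using Fbar_triangle[of T y z x] yz(5) by (meson order_le_less_trans)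
  qed
  then show "\<exists>y\<in>X. dist x y < r \<and> Fbar T x y > ereal (\<epsilon> / 3)" using yz by blast
qed

lemma weakly_mean_equicontinuous_not_strong_mean_sensitive:
  assumes "X \<noteq> {}" and "weakly_mean_equicontinuous X T"
  shows "\<not> strong_mean_sensitive X T"
proof
  assume "strong_mean_sensitive X T"
  then obtain \<delta> :: real where "\<delta> > 0" and \<delta>:
      "\<And>x \<epsilon>. x \<in> X \<Longrightarrow> \<epsilon> > 0 \<Longrightarrow> \<exists>y\<in>X. dist x y < \<epsilon> \<and> Fbar T x y > ereal \<delta>"
    unfolding strong_mean_sensitive_def by blast
  obtain \<eta> :: real where "\<eta> > 0" and \<eta>:
      "\<And>x y. x \<in> X \<Longrightarrow> y \<in> X \<Longrightarrow> dist x y < \<eta> \<Longrightarrow> Fbar T x y < ereal \<delta>"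
    using assms(2) \<open>\<delta> > 0\<close> unfolding weakly_mean_equicontinuous_def by blast
  obtain x where "x \<in> X" using assms(1) by blast
  then show False using \<delta>[of x \<eta>] \<eta>[of x] \<open>\<eta> > 0\<close> by (meson less_asym)
qed

theorem corollary5p6:
  fixes X :: "'a::metric_space set" and T :: "'a \<Rightarrow> 'a"
  assumes "topological_dynamical_system X T"
    and "minimal_system X T"
  shows "(weakly_mean_equicontinuous X T \<or> strong_mean_sensitive X T) \<and>
    \<not> (weakly_mean_equicontinuous X T \<and> strong_mean_sensitive X T)"
proof
  have "X \<noteq> {}" "compact X"
    using assms(1) unfolding topological_dynamical_system_def by auto
  show "weakly_mean_equicontinuous X T \<or> strong_mean_sensitive X T"
  proof (cases "\<exists>\<epsilon>>0. \<forall>x\<in>X. \<not> Fbar_small_near X T \<epsilon> x")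
    case True
    then show ?thesis using strong_mean_sensitiveI_local by blast
  next
    case False
    then have "Fbar_small_near X T \<epsilon> x" if "\<epsilon> > 0" "x \<in> X" for \<epsilon> x
      using Fbar_small_near_all_if_one[OF assms] that by blast
    then show ?thesis using weakly_mean_equicontinuousI_local[OF \<open>compact X\<close>] by blast
  qed
  show "\<not> (weakly_mean_equicontinuous X T \<and> strong_mean_sensitive X T)"
    using weakly_mean_equicontinuous_not_strong_mean_sensitive[OF \<open>X \<noteq> {}\<close>] by blast
qed

end
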